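(* Let $X$ be a finite-dimensional (Hilbert) space, and let $T\colon X\to X$ be a single-valued mapping that is Lipschitz continuous around $\bar x\in\mathrm{dom}\,T$. The following are equivalent: (i) $T$ is locally strongly monotone around $(\bar x,T(\bar x))$. (ii) $D^*T(\bar x)$ is positive-definite in the sense that $$\langle z,w\rangle>0\quad\text{whenever } z\in D^*T(\bar x)(w),\ w\ne0.$$
   Context: $T$ is locally strongly monotone around $(\bar x,\bar v)\in\mathrm{gph}\,T$ if there are a modulus $\kappa>0$ and a neighborhood $U\times V$ of $(\bar x,\bar v)$ such that $\langle v_1-v_2,u_1-u_2\rangle\ge\kappa\|u_1-u_2\|^2$ for all $(u_1,v_1),(u_2,v_2)\in\mathrm{gph}\,T\cap(U\times V)$. For a set $\Omega$ in a finite-dimensional Euclidean space, locally closed around $\bar z\in\Omega$: the regular normal cone is $\widehat N_\Omega(\bar z)=\{\zeta:\limsup_{z\to\bar z,\,z\in\Omega}\langle\zeta,z-\bar z\rangle/\|z-\bar z\|\le0\}$, and the limiting normal cone $N_\Omega(\bar z)$ consists of all limits $\zeta=\lim\zeta_k$ with $\zeta_k\in\widehat N_\Omega(z_k)$, $z_k\in\Omega$, $z_k\to\bar z$. The limiting coderivative of $T$ at $\bar x$ is $D^*T(\bar x)(w)=\{z\in X:(z,-w)\in N_{\mathrm{gph}\,T}(\bar x,T(\bar x))\}$, $w\in X$. *)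

theory Defs
  imports "HOL-Analysis.Analysis"
begin

text \<open>Set-valued mappings between Euclidean spaces are represented by their graphs.
  A single-valued mapping, possibly only partially defined, is given by its domain \<open>D\<close>
  together with a function \<open>T\<close> whose values outside \<open>D\<close> are irrelevant.\<close>

definition gph :: "'a set \<Rightarrow> ('a \<Rightarrow> 'b) \<Rightarrow> ('a \<times> 'b) set" where
  "gph D T = {(x, T x) | x. x \<in> D}"

text \<open>Lipschitz continuity around a point requires the mapping to be defined on a whole
  neighbourhood of that point.\<close>

definition lipschitz_around ::
    "'a::metric_space set \<Rightarrow> ('a \<Rightarrow> 'b::metric_space) \<Rightarrow> 'a \<Rightarrow> bool" where
  "lipschitz_around D T x \<longleftrightarrow>
     (\<exists>U L. open U \<and> x \<in> U \<and> U \<subseteq> D \<and> L-lipschitz_on U T)"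

definition locally_strongly_monotone ::
    "('a::real_inner \<times> 'a) set \<Rightarrow> 'a \<times> 'a \<Rightarrow> bool" where
  "locally_strongly_monotone G p \<longleftrightarrow>
     p \<in> G \<and>
     (\<exists>\<kappa>>0. \<exists>U V. open U \<and> open V \<and> p \<in> U \<times> V \<and>
        (\<forall>(u1, v1) \<in> G \<inter> (U \<times> V). \<forall>(u2, v2) \<in> G \<inter> (U \<times> V).
           (v1 - v2) \<bullet> (u1 - u2) \<ge> \<kappa> * (norm (u1 - u2))\<^sup>2))"

text \<open>The upper limit is taken in the extended reals, so that at an isolated point of
  \<open>\<Omega>\<close> it is \<open>-\<infinity>\<close> and the cone is the whole space.\<close>

definition regular_normal_cone :: "'a::euclidean_space set \<Rightarrow> 'a \<Rightarrow> 'a set" where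
  "regular_normal_cone \<Omega> z0 =
     {\<zeta>. Limsup (at z0 within \<Omega>)
            (\<lambda>z. ereal (\<zeta> \<bullet> (z - z0) / norm (z - z0))) \<le> 0}"

definition limiting_normal_cone :: "'a::euclidean_space set \<Rightarrow> 'a \<Rightarrow> 'a set" where
  "limiting_normal_cone \<Omega> z0 =
     {\<zeta>. \<exists>z \<xi>. (\<forall>k::nat. z k \<in> \<Omega> \<and> \<xi> k \<in> regular_normal_cone \<Omega> (z k)) \<and>
            z \<longlonglongrightarrow> z0 \<and> \<xi> \<longlonglongrightarrow> \<zeta>}"

definition limiting_coderivative ::
    "'a::euclidean_space set \<Rightarrow> ('a \<Rightarrow> 'a) \<Rightarrow> 'a \<Rightarrow> 'a \<Rightarrow> 'a set" where
  "limiting_coderivative D T x w =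
     {z. (z, - w) \<in> limiting_normal_cone (gph D T) (x, T x)}"

end

theory Submission
  imports Defs
begin

text \<open>
  The link between the two conditions is the scalarization principle: for a map that is Lipschitz
  around \<open>x\<close>, a pair \<open>(z, - w)\<close> is a regular normal to the graph at \<open>(x, T x)\<close> exactly when \<open>z\<close> is
  a regular (Frechet) subgradient at \<open>x\<close> of the real function \<open>y \<mapsto> w \<bullet> T y\<close>
  (\<open>regular_normal_cone_gph_iff\<close>). Both conditions are compared with the uniform bound
  \<open>z \<bullet> w \<ge> \<kappa> |w|\<^sup>2\<close> for the regular normals \<open>(z, - w)\<close> at all points of the graph near
  \<open>(xbar, T xbar)\<close>.

  Strong monotonicity gives this bound by testing the subgradient inequality at the points
  \<open>x - t w\<close> with \<open>t \<rightarrow> 0+\<close>, and the bound survives the passage to limiting normals.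

  Conversely, suppose that the limiting coderivative is positive-definite. If the uniform bound
  failed for every \<open>\<kappa>\<close>, there would be normals \<open>(z, - w)\<close> with \<open>|w| = 1\<close> at points converging to
  \<open>(xbar, T xbar)\<close> and with \<open>z \<bullet> w\<close> asymptotically nonpositive; since \<open>|z| \<le> L |w|\<close>, a subsequence
  of them converges to a limiting normal that contradicts positive-definiteness. The uniform bound
  is then integrated along the segment from \<open>a\<close> to \<open>b\<close>: with \<open>w = b - a\<close>, an approximate mean value
  inequality for the scalar function \<open>y \<mapsto> w \<bullet> T y\<close> (\<open>mean_value_proximal_subgradient\<close>) turns a
  violation of \<open>(T b - T a) \<bullet> (b - a) \<ge> \<kappa> |b - a|\<^sup>2\<close> into a subgradient that violates the uniform
  bound. The mean value inequality itself comes from minimizing a quadratic penalty function.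
\<close>

section \<open>Regular normals to the graph of a Lipschitz map\<close>

lemma regular_normal_cone_iff:
  "\<zeta> \<in> regular_normal_cone \<Omega> z0 \<longleftrightarrow>
     (\<forall>\<epsilon>>0. \<forall>\<^sub>F z in at z0 within \<Omega>. \<zeta> \<bullet> (z - z0) \<le> \<epsilon> * norm (z - z0))"
  (is "?L \<longleftrightarrow> ?R")
proof -
  let ?q = "\<lambda>z. \<zeta> \<bullet> (z - z0) / norm (z - z0)"
  have "?L \<longleftrightarrow> (\<forall>y>0. \<forall>\<^sub>F z in at z0 within \<Omega>. ereal (?q z) < y)"
    unfolding regular_normal_cone_def by (simp add: Limsup_le_iff)
  also have "\<dots> \<longleftrightarrow> (\<forall>\<epsilon>>0. \<forall>\<^sub>F z in at z0 within \<Omega>. ?q z \<le> \<epsilon>)"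
  proof safe
    fix \<epsilon> :: real assume *: "\<forall>y>0. \<forall>\<^sub>F z in at z0 within \<Omega>. ereal (?q z) < y" and "\<epsilon> > 0"
    then have "\<forall>\<^sub>F z in at z0 within \<Omega>. ereal (?q z) < ereal \<epsilon>"
      using *[rule_format, of "ereal \<epsilon>"] by simp
    then show "\<forall>\<^sub>F z in at z0 within \<Omega>. ?q z \<le> \<epsilon>" by eventually_elim simp
  next
    fix y :: ereal assume *: "\<forall>\<epsilon>>0. \<forall>\<^sub>F z in at z0 within \<Omega>. ?q z \<le> \<epsilon>" and "y > 0"
    then obtain \<epsilon> where e: "0 < ereal \<epsilon>" "ereal \<epsilon> < y" using ereal_dense2 by blast
    then have "\<forall>\<^sub>F z in at z0 within \<Omega>. ?q z \<le> \<epsilon>" using * by simp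
    then show "\<forall>\<^sub>F z in at z0 within \<Omega>. ereal (?q z) < y"
      by eventually_elim (use e in \<open>meson ereal_less_eq(3) le_less_trans\<close>)
  qed
  also have "\<dots> \<longleftrightarrow> ?R"
  proof -
    have "(\<forall>\<^sub>F z in at z0 within \<Omega>. ?q z \<le> \<epsilon>) \<longleftrightarrow>
        (\<forall>\<^sub>F z in at z0 within \<Omega>. \<zeta> \<bullet> (z - z0) \<le> \<epsilon> * norm (z - z0))" for \<epsilon>
      unfolding eventually_at_filter by (rule eventually_cong[OF always_eventually]) (auto simp: divide_le_eq)
    then show ?thesis by simp
  qed
  finally show ?thesis .
qed

text \<open>
  Since \<open>|x' - x| \<le> |(x', T x') - (x, T x)| \<le> (1 + L) |x' - x|\<close> near \<open>x\<close>, distances on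
  the graph and distances in the domain give the same notion of a first-order error term.
\<close>

lemma regular_normal_cone_gph_iff:
  fixes T :: "'a::euclidean_space \<Rightarrow> 'b::euclidean_space"
  assumes U: "open U" "U \<subseteq> D" "x \<in> U" and lip: "L-lipschitz_on U T"
  shows "(z, - w) \<in> regular_normal_cone (gph D T) (x, T x) \<longleftrightarrow>
     (\<forall>\<epsilon>>0. \<forall>\<^sub>F x' in at x. z \<bullet> (x' - x) - w \<bullet> (T x' - T x) \<le> \<epsilon> * norm (x' - x))"
proof -
  have L: "L \<ge> 0" using lip by (rule lipschitz_on_nonneg)
  have T: "isCont T x"
    using lipschitz_on_continuous_on[OF lip] U continuous_on_eq_continuous_at by blast
  have up: "norm ((x', T x') - (x, T x)) \<le> (1 + L) * norm (x' - x)" if "x' \<in> U" for x'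
  proof -
    have "norm ((x', T x') - (x, T x)) \<le> norm (x' - x) + norm (T x' - T x)"
      using norm_Pair_le[of "x' - x" "T x' - T x"] by simp
    also have "norm (T x' - T x) \<le> L * norm (x' - x)"
      using lipschitz_onD[OF lip that U(3)] by (simp add: dist_norm)
    finally show ?thesis by (simp add: algebra_simps)
  qed
  have evU: "\<forall>\<^sub>F x' in at x. x' \<in> U \<and> x' \<noteq> x"
    using U eventually_at_topological by blast
  have to_gph: "filterlim (\<lambda>x'. (x', T x')) (at (x, T x) within gph D T) (at x)"
    unfolding filterlim_at
  proof
    show "\<forall>\<^sub>F x' in at x. (x', T x') \<in> gph D T \<and> (x', T x') \<noteq> (x, T x)"
      using evU by eventually_elim (use U in \<open>auto simp: gph_def\<close>)
    show "((\<lambda>x'. (x', T x')) \<longlongrightarrow> (x, T x)) (at x)"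
      using T by (intro tendsto_Pair) (auto simp: isCont_def)
  qed
  have from_gph: "filterlim fst (at x) (at (x, T x) within gph D T)"
    unfolding filterlim_at
  proof
    show "\<forall>\<^sub>F p in at (x, T x) within gph D T. fst p \<in> UNIV \<and> fst p \<noteq> x"
      unfolding eventually_at_filter by (rule always_eventually) (auto simp: gph_def)
    show "(fst \<longlongrightarrow> x) (at (x, T x) within gph D T)"
      using tendsto_fst[OF tendsto_ident_at[of "(x, T x)" "gph D T"]] by simp
  qed
  show ?thesis
    unfolding regular_normal_cone_iff
  proof safe
    fix \<epsilon> :: real
    assume *: "\<forall>\<epsilon>>0. \<forall>\<^sub>F p in at (x, T x) within gph D T.
        (z, - w) \<bullet> (p - (x, T x)) \<le> \<epsilon> * norm (p - (x, T x))" and e: "\<epsilon> > 0"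
    define \<delta> where "\<delta> = \<epsilon> / (1 + L)"
    have \<delta>: "\<delta> > 0" using e L by (simp add: \<delta>_def)
    from eventually_compose_filterlim[OF *[rule_format, OF \<delta>] to_gph] evU
    show "\<forall>\<^sub>F x' in at x. z \<bullet> (x' - x) - w \<bullet> (T x' - T x) \<le> \<epsilon> * norm (x' - x)"
    proof eventually_elim
      case (elim x')
      have "z \<bullet> (x' - x) - w \<bullet> (T x' - T x) \<le> \<delta> * norm ((x', T x') - (x, T x))"
        using elim(1) by simp
      also have "\<dots> \<le> \<delta> * ((1 + L) * norm (x' - x))"
        using up elim(2) \<delta> by (intro mult_left_mono) auto
      also have "\<dots> = \<epsilon> * norm (x' - x)" using L by (simp add: \<delta>_def)
      finally show ?case .
    qed
  next
    fix \<epsilon> :: real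
    assume *: "\<forall>\<epsilon>>0. \<forall>\<^sub>F x' in at x. z \<bullet> (x' - x) - w \<bullet> (T x' - T x) \<le> \<epsilon> * norm (x' - x)"
      and e: "\<epsilon> > 0"
    have gph: "\<forall>\<^sub>F p in at (x, T x) within gph D T. p \<in> gph D T"
      by (auto simp: eventually_at_filter)
    from eventually_compose_filterlim[OF *[rule_format, OF e] from_gph] gph
    show "\<forall>\<^sub>F p in at (x, T x) within gph D T.
        (z, - w) \<bullet> (p - (x, T x)) \<le> \<epsilon> * norm (p - (x, T x))"
    proof eventually_elim
      case (elim p)
      then obtain x' where p: "p = (x', T x')" by (auto simp: gph_def)
      have "(z, - w) \<bullet> (p - (x, T x)) \<le> \<epsilon> * norm (x' - x)" using elim(1) by (simp add: p)
      also have "norm (x' - x) \<le> norm (p - (x, T x))"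
        using norm_fst_le[of "x' - x" "T x' - T x"] by (simp add: p)
      finally show ?case using e by simp
    qed
  qed
qed

text \<open>
  Each of the two bounds on \<open>z\<close> derived below from the subgradient inequality comes from one
  well-chosen direction \<open>h\<close>: \<open>z\<close> itself for \<open>|z| \<le> L |w|\<close>, and \<open>- w\<close> for \<open>z \<bullet> w \<ge> \<kappa> |w|\<^sup>2\<close>.
\<close>

lemma regular_normal_gph_along_ray:
  fixes T :: "'a::euclidean_space \<Rightarrow> 'b::euclidean_space"
  assumes "open U" "U \<subseteq> D" "x \<in> U" "L-lipschitz_on U T"
    and "(z, - w) \<in> regular_normal_cone (gph D T) (x, T x)"
    and "h \<noteq> 0" "\<epsilon> > 0"
  shows "\<forall>\<^sub>F t in at_right 0. t * (z \<bullet> h) - w \<bullet> (T (x + t *\<^sub>R h) - T x) \<le> \<epsilon> * (t * norm h)"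
proof -
  have "filterlim (\<lambda>t. x + t *\<^sub>R h) (at x) (at_right (0::real))"
    unfolding filterlim_at
  proof
    show "\<forall>\<^sub>F t in at_right (0::real). x + t *\<^sub>R h \<in> UNIV \<and> x + t *\<^sub>R h \<noteq> x"
      using eventually_at_right_less[of "0::real"] by eventually_elim (use assms(6) in auto)
    show "((\<lambda>t. x + t *\<^sub>R h) \<longlongrightarrow> x) (at_right (0::real))"
      by (auto intro!: tendsto_eq_intros)
  qed
  moreover have "\<forall>\<^sub>F x' in at x. z \<bullet> (x' - x) - w \<bullet> (T x' - T x) \<le> \<epsilon> * norm (x' - x)"
    using assms regular_normal_cone_gph_iff[OF assms(1-4)] by blast
  ultimately have "\<forall>\<^sub>F t in at_right (0::real). z \<bullet> (t *\<^sub>R h) - w \<bullet> (T (x + t *\<^sub>R h) - T x)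
      \<le> \<epsilon> * norm (t *\<^sub>R h)"
    by (auto dest: eventually_compose_filterlim)
  with eventually_at_right_less[of "0::real"] show ?thesis
    by eventually_elim simp
qed

lemma eventually_ray_in_open:
  fixes x h :: "'a::real_normed_vector"
  assumes "open U" "x \<in> U"
  shows "\<forall>\<^sub>F t in at_right (0::real). x + t *\<^sub>R h \<in> U"
proof -
  have "((\<lambda>t. x + t *\<^sub>R h) \<longlongrightarrow> x) (at_right (0::real))"
    by (auto intro!: tendsto_eq_intros)
  then show ?thesis using assms by (rule topological_tendstoD)
qed

text \<open>
  Testing the subgradient inequality in the direction \<open>z\<close> itself shows that the subgradients of
  \<open>y \<mapsto> w \<bullet> T y\<close> are bounded by the Lipschitz constant \<open>L |w|\<close> of this function.
\<close>

lemma regular_normal_gph_norm_le: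
  fixes T :: "'a::euclidean_space \<Rightarrow> 'b::euclidean_space"
  assumes U: "open U" "U \<subseteq> D" "x \<in> U" and lip: "L-lipschitz_on U T"
    and nrm: "(z, - w) \<in> regular_normal_cone (gph D T) (x, T x)"
  shows "norm z \<le> L * norm w"
proof (cases "z = 0")
  case True
  then show ?thesis using lipschitz_on_nonneg[OF lip] by simp
next
  case False
  show ?thesis
  proof (rule field_le_epsilon)
    fix \<epsilon> :: real assume e: "\<epsilon> > 0"
    have "\<forall>\<^sub>F t in at_right (0::real). norm z \<le> L * norm w + \<epsilon>"
      using regular_normal_gph_along_ray[OF U lip nrm False e]
        eventually_ray_in_open[OF U(1,3), of z] eventually_at_right_less[of "0::real"]
    proof eventually_elim
      case (elim t)
      have "w \<bullet> (T (x + t *\<^sub>R z) - T x) \<le> norm w * norm (T (x + t *\<^sub>R z) - T x)"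
        by (rule norm_cauchy_schwarz)
      also have "\<dots> \<le> norm w * (L * (t * norm z))"
        using lipschitz_onD[OF lip elim(2) U(3)] elim(3)
        by (intro mult_left_mono) (auto simp: dist_norm)
      finally have "t * (z \<bullet> z) \<le> norm w * (L * (t * norm z)) + \<epsilon> * (t * norm z)"
        using elim(1) by linarith
      then have "(t * norm z) * norm z \<le> (t * norm z) * (L * norm w + \<epsilon>)"
        by (simp add: dot_square_norm power2_eq_square algebra_simps)
      then show ?case using elim(3) False by (subst (asm) mult_le_cancel_left_pos) auto
    qed
    then show "norm z \<le> L * norm w + \<epsilon>" by simp
  qed
qed

section \<open>Strong monotonicity gives a positive-definite coderivative\<close>

text \<open>
  The test direction is \<open>- w\<close>: there monotonicity gives \<open>- w \<bullet> (T (x - t w) - T x) \<ge> t \<kappa> |w|\<^sup>2\<close>,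
  which is of first order in \<open>t\<close>.
\<close>

lemma regular_normal_gph_strongly_monotone:
  fixes T :: "'a::euclidean_space \<Rightarrow> 'a"
  assumes U: "open U" "U \<subseteq> D" "x \<in> U" and lip: "L-lipschitz_on U T"
    and mono: "\<And>x'. x' \<in> U \<Longrightarrow> \<kappa> * (norm (x' - x))\<^sup>2 \<le> (T x' - T x) \<bullet> (x' - x)"
    and nrm: "(z, - w) \<in> regular_normal_cone (gph D T) (x, T x)"
  shows "\<kappa> * (norm w)\<^sup>2 \<le> z \<bullet> w"
proof (cases "w = 0")
  case False
  show ?thesis
  proof (rule field_le_epsilon)
    fix \<epsilon> :: real assume e: "\<epsilon> > 0"
    define \<delta> where "\<delta> = \<epsilon> / norm w"
    have \<delta>: "\<delta> > 0" "\<delta> * norm w = \<epsilon>" using e False by (auto simp: \<delta>_def)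
    have "- w \<noteq> 0" using False by simp
    note ray = regular_normal_gph_along_ray[OF U lip nrm this \<delta>(1)]
    have "\<forall>\<^sub>F t in at_right (0::real). \<kappa> * (norm w)\<^sup>2 \<le> z \<bullet> w + \<epsilon>"
      using ray eventually_ray_in_open[OF U(1,3), of "- w"] eventually_at_right_less[of "0::real"]
    proof eventually_elim
      case (elim t)
      have "t * (t * (\<kappa> * (norm w)\<^sup>2)) \<le> t * (- (w \<bullet> (T (x + t *\<^sub>R - w) - T x)))"
        using mono[OF elim(2)] by (simp add: power_mult_distrib power2_eq_square inner_commute mult_ac)
      then have "t * (\<kappa> * (norm w)\<^sup>2) \<le> - (w \<bullet> (T (x + t *\<^sub>R - w) - T x))"
        using elim(3) by (subst (asm) mult_le_cancel_left_pos)
      moreover have "\<delta> * (t * norm (- w)) = t * \<epsilon>" by (simp add: \<delta>(2)[symmetric])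
      moreover have "t * (z \<bullet> - w) = - (t * (z \<bullet> w))" by simp
      ultimately have "t * (\<kappa> * (norm w)\<^sup>2) \<le> t * (z \<bullet> w) + t * \<epsilon>"
        using elim(1) by linarith
      then have "t * (\<kappa> * (norm w)\<^sup>2) \<le> t * (z \<bullet> w + \<epsilon>)"
        by (simp add: distrib_left)
      then show ?case using elim(3) by (subst (asm) mult_le_cancel_left_pos)
    qed
    then show "\<kappa> * (norm w)\<^sup>2 \<le> z \<bullet> w + \<epsilon>" by simp
  qed
qed simp

lemma limiting_coderivative_lower_bound:
  fixes T :: "'a::euclidean_space \<Rightarrow> 'a"
  assumes W: "open W" "(x, T x) \<in> W"
    and bound: "\<And>y z w. y \<in> D \<Longrightarrow> (y, T y) \<in> W \<Longrightarrow>
        (z, - w) \<in> regular_normal_cone (gph D T) (y, T y) \<Longrightarrow> \<kappa> * (norm w)\<^sup>2 \<le> z \<bullet> w"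
    and z: "z \<in> limiting_coderivative D T x w"
  shows "\<kappa> * (norm w)\<^sup>2 \<le> z \<bullet> w"
proof -
  obtain p \<xi> where p: "\<And>k::nat. p k \<in> gph D T" "\<And>k. \<xi> k \<in> regular_normal_cone (gph D T) (p k)"
    and lim: "p \<longlonglongrightarrow> (x, T x)" "\<xi> \<longlonglongrightarrow> (z, - w)"
    using z unfolding limiting_coderivative_def limiting_normal_cone_def by blast
  have "\<forall>\<^sub>F k in sequentially. p k \<in> W" using lim(1) W by (rule topological_tendstoD)
  then have ev: "\<forall>\<^sub>F k in sequentially. \<kappa> * (norm (snd (\<xi> k)))\<^sup>2 \<le> fst (\<xi> k) \<bullet> (- snd (\<xi> k))"
  proof eventually_elim
    case (elim k)
    obtain y where "y \<in> D" "p k = (y, T y)" using p(1)[of k] by (auto simp: gph_def)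
    then show ?case
      using bound[of y "fst (\<xi> k)" "- snd (\<xi> k)"] p(2)[of k] elim by simp
  qed
  have l: "(\<lambda>k. \<kappa> * (norm (snd (\<xi> k)))\<^sup>2) \<longlonglongrightarrow> \<kappa> * (norm (snd (z, - w)))\<^sup>2"
    by (intro tendsto_intros lim)
  have r: "(\<lambda>k. fst (\<xi> k) \<bullet> (- snd (\<xi> k))) \<longlonglongrightarrow> fst (z, - w) \<bullet> (- snd (z, - w))"
    by (intro tendsto_intros lim)
  have "\<kappa> * (norm (snd (z, - w)))\<^sup>2 \<le> fst (z, - w) \<bullet> (- snd (z, - w))"
    by (rule tendsto_le[OF _ r l ev]) simp
  then show ?thesis by simp
qed

section \<open>An approximate mean value inequality\<close>

text \<open>
  If \<open>f b - f a < c\<close>, the mean slope of \<open>f\<close> on the segment is too small, and a subgradient with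
  too small a slope should exist nearby. Pick \<open>c'\<close> with \<open>f b - f a < c' < c\<close> and minimize
  \<open>f (a + t (b - a) + d) - c' t + N |d|\<^sup>2\<close> over \<open>t \<in> [0, 1]\<close> and \<open>|d| \<le> e\<close>. At a minimizer let
  \<open>x = a + t (b - a) + d\<close>. For large \<open>N\<close> the offset \<open>d\<close> is interior, so varying \<open>x\<close> with \<open>t\<close>
  fixed makes \<open>\<zeta> = - 2 N d\<close> a proximal subgradient at \<open>x\<close>. Also for large \<open>N\<close>, the minimizer has
  \<open>t \<noteq> 0\<close>, because the value at \<open>t = 1\<close>, \<open>d = 0\<close> is smaller than any value at \<open>t = 0\<close>. So \<open>t\<close> may be
  decreased with \<open>x\<close> fixed, which yields \<open>\<zeta> \<bullet> (b - a) \<le> c'\<close>; this includes the endpoint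
  \<open>t = 1\<close>, where only the decrease is possible.
\<close>

lemma mean_value_proximal_subgradient:
  fixes f :: "'a::euclidean_space \<Rightarrow> real"
  assumes U: "open U" "closed_segment a b \<subseteq> U" and lip: "L-lipschitz_on U f"
    and c: "f b - f a < c"
  obtains x \<zeta> N where "x \<in> U" "N \<ge> 0" "\<zeta> \<bullet> (b - a) < c"
    "\<forall>\<^sub>F x' in nhds x. f x' - f x \<ge> \<zeta> \<bullet> (x' - x) - N * (norm (x' - x))\<^sup>2"
proof -
  define h where "h = b - a"
  have L: "L \<ge> 0" using lip by (rule lipschitz_on_nonneg)
  obtain c' where c': "f b - f a < c'" "c' < c" using c dense by blast
  obtain e where e: "e > 0" "(\<Union>y\<in>closed_segment a b. cball y e) \<subseteq> U"
    using compact_subset_open_imp_cball_epsilon_subset[OF compact_segment U] by blast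
  have seg: "a + t *\<^sub>R h \<in> closed_segment a b" if "t \<in> {0..1}" for t
    using that by (auto simp: in_segment h_def algebra_simps intro!: exI[of _ t])
  have inU: "a + t *\<^sub>R h + d \<in> U" if "t \<in> {0..1}" "norm d \<le> e" for t d
  proof -
    have "a + t *\<^sub>R h + d \<in> cball (a + t *\<^sub>R h) e" using that(2) by (simp add: dist_norm)
    then show ?thesis using e(2) seg[OF that(1)] by blast
  qed
  define gap where "gap = f a - f b + c'"
  have gap: "gap > 0" using c' by (simp add: gap_def)
  \<comment> \<open>The last two summands ensure \<open>L / N < e\<close> and \<open>L\<^sup>2 / N < gap\<close>.\<close>
  define N where "N = 1 + L / e + L\<^sup>2 / gap"
  have N: "N > 0" "L < N * e" "L\<^sup>2 < N * gap"
  proof -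
    have nn: "0 \<le> L / e" "0 \<le> L\<^sup>2 / gap" using e(1) gap L by simp_all
    then show "N > 0" by (simp add: N_def)
    have "L / e < N" "L\<^sup>2 / gap < N" using nn by (simp_all add: N_def)
    then show "L < N * e" "L\<^sup>2 < N * gap" using e(1) gap by (simp_all add: pos_divide_less_eq)
  qed
  define \<phi> where "\<phi> = (\<lambda>(d, t). f (a + t *\<^sub>R h + d) - c' * t + N * (norm d)\<^sup>2)"
  let ?K = "cball (0::'a) e \<times> {0..1::real}"
  have "continuous_on ?K \<phi>"
    unfolding \<phi>_def split_beta
    by (intro continuous_intros continuous_on_compose2[OF lipschitz_on_continuous_on[OF lip]])
       (use inU in auto)
  moreover have "compact ?K" "?K \<noteq> {}" using e(1) by (auto intro!: compact_Times)
  ultimately obtain m where "m \<in> ?K" "\<forall>p\<in>?K. \<phi> m \<le> \<phi> p"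
    using continuous_attains_inf[of ?K \<phi>] by blast
  then obtain d t where dt: "norm d \<le> e" "t \<in> {0..1}"
    and min: "\<And>d' t'. norm d' \<le> e \<Longrightarrow> t' \<in> {0..1} \<Longrightarrow> \<phi> (d, t) \<le> \<phi> (d', t')"
    by (cases m) auto
  \<comment> \<open>Compare with offset 0: the penalty is at most the possible gain \<open>L |d|\<close> in \<open>f\<close>.\<close>
  have Nd: "N * norm d \<le> L"
  proof (cases "d = 0")
    case False
    have "\<bar>f (a + t *\<^sub>R h + d) - f (a + t *\<^sub>R h)\<bar> \<le> L * norm d"
      using lipschitz_onD[OF lip inU[OF dt(2,1)], of "a + t *\<^sub>R h"] inU[OF dt(2), of 0] e(1)
      by (simp add: dist_norm)
    moreover have "f (a + t *\<^sub>R h + d) + N * (norm d)\<^sup>2 \<le> f (a + t *\<^sub>R h)"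
      using min[of 0 t] dt e(1) by (simp add: \<phi>_def)
    ultimately have "norm d * (N * norm d) \<le> norm d * L"
      by (simp add: power2_eq_square algebra_simps)
    then show ?thesis using False by (subst (asm) mult_le_cancel_left_pos) auto
  qed (use L in simp)
  have d_lt: "norm d < e"
  proof -
    have "N * norm d < N * e" using Nd N(2) by linarith
    then show ?thesis using N(1) by simp
  qed
  \<comment> \<open>At \<open>t = 0\<close>, leaving \<open>a\<close> lowers \<open>f\<close> by at most \<open>L |d| \<le> L\<^sup>2 / N\<close>, which is less than \<open>gap\<close>.\<close>
  have t_pos: "t > 0"
  proof (rule ccontr)
    assume "\<not> t > 0"
    then have t: "t = 0" using dt(2) by simp
    have "\<bar>f (a + d) - f a\<bar> \<le> L * norm d"
      using lipschitz_onD[OF lip, of "a + d" a] inU[of 0 d] inU[of 0 0] dt e(1) by (simp add: dist_norm)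
    moreover have "f (a + d) + N * (norm d)\<^sup>2 \<le> f b - c'"
      using min[of 0 1] dt e(1) by (simp add: \<phi>_def t h_def)
    moreover have "N * (norm d)\<^sup>2 \<ge> 0" using N(1) by simp
    ultimately have "gap \<le> L * norm d" by (simp add: gap_def)
    then have "N * gap \<le> N * (L * norm d)" using N(1) by simp
    also have "\<dots> = L * (N * norm d)" by simp
    also have "\<dots> \<le> L * L" using Nd L by (rule mult_left_mono)
    finally show False using N(3) by (simp add: power2_eq_square)
  qed
  define x where "x = a + t *\<^sub>R h + d"
  define \<zeta> where "\<zeta> = - (2 * N) *\<^sub>R d"
  have "\<forall>\<^sub>F x' in nhds x. f x' - f x \<ge> \<zeta> \<bullet> (x' - x) - N * (norm (x' - x))\<^sup>2"
  proof -
    have "((\<lambda>x'. norm (x' - x + d)) \<longlongrightarrow> norm (x - x + d)) (nhds x)"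
      by (intro tendsto_intros filterlim_ident)
    then have "\<forall>\<^sub>F x' in nhds x. norm (x' - x + d) < e"
      by (rule order_tendstoD) (use d_lt in simp)
    then show ?thesis
    proof eventually_elim
      case (elim x')
      have sq: "(norm (x' - x + d))\<^sup>2 = (norm (x' - x))\<^sup>2 + 2 * (d \<bullet> (x' - x)) + (norm d)\<^sup>2"
        by (simp add: power2_norm_eq_inner inner_add_left inner_add_right inner_commute)
      have "f x + N * (norm d)\<^sup>2 \<le> f x' + N * (norm (x' - x + d))\<^sup>2"
        using min[of "x' - x + d" t] elim dt(2) by (simp add: \<phi>_def x_def)
      then show ?case unfolding sq by (simp add: \<zeta>_def algebra_simps)
    qed
  qed
  moreover have "\<zeta> \<bullet> (b - a) \<le> c'"
  proof (rule tendsto_lowerbound)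
    \<comment> \<open>Replacing \<open>(d, t)\<close> by \<open>(d + s h, t - s)\<close> leaves \<open>x\<close> unchanged.\<close>
    show "((\<lambda>s. c' + N * (norm h)\<^sup>2 * s) \<longlongrightarrow> c') (at_right 0)"
      by (auto intro!: tendsto_eq_intros)
    have "((\<lambda>s. norm (d + s *\<^sub>R h)) \<longlongrightarrow> norm (d + 0 *\<^sub>R h)) (at_right 0)"
      by (intro tendsto_intros)
    then have "\<forall>\<^sub>F s in at_right 0. norm (d + s *\<^sub>R h) < e"
      by (rule order_tendstoD) (use d_lt in simp)
    moreover have "\<forall>\<^sub>F s in at_right 0. s < t"
      using t_pos eventually_at_right_field by blast
    ultimately show "\<forall>\<^sub>F s in at_right 0. \<zeta> \<bullet> (b - a) \<le> c' + N * (norm h)\<^sup>2 * s"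
      using eventually_at_right_less[of "0::real"]
    proof eventually_elim
      case (elim s)
      have sq: "(norm (d + s *\<^sub>R h))\<^sup>2 = (norm d)\<^sup>2 + 2 * s * (d \<bullet> h) + s\<^sup>2 * (norm h)\<^sup>2"
        by (simp only: power2_norm_eq_inner)
          (simp add: inner_add_left inner_add_right inner_commute power2_eq_square)
      have same_x: "a + (t - s) *\<^sub>R h + (d + s *\<^sub>R h) = x" by (simp add: x_def algebra_simps)
      have "\<phi> (d, t) \<le> \<phi> (d + s *\<^sub>R h, t - s)"
        using elim dt(2) by (intro min) auto
      then have "f x - c' * t + N * (norm d)\<^sup>2 \<le> f x - c' * (t - s) + N * (norm (d + s *\<^sub>R h))\<^sup>2"
        unfolding \<phi>_def prod.case same_x by (simp only: x_def)
      then have "s * (\<zeta> \<bullet> h) \<le> s * (c' + N * (norm h)\<^sup>2 * s)"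
        unfolding sq by (simp add: \<zeta>_def algebra_simps power2_eq_square)
      then show ?case using elim(3) unfolding h_def[symmetric]
        by (subst (asm) mult_le_cancel_left_pos)
    qed
  qed simp
  ultimately show thesis
    using that[of x N \<zeta>] inU[OF dt(2,1)] N(1) c'(2) by (simp add: x_def)
qed

text \<open>
  The mean value inequality is applied to \<open>y \<mapsto> w \<bullet> T y\<close> with \<open>w = b - a\<close>, so that the increment of
  the function and the slope of its subgradients are the two quantities to be compared.
\<close>

lemma strongly_monotone_of_regular_normals:
  fixes T :: "'a::euclidean_space \<Rightarrow> 'a"
  assumes U: "open U" "U \<subseteq> D" "closed_segment a b \<subseteq> U" and lip: "L-lipschitz_on U T"
    and bound: "\<And>x z w. x \<in> U \<Longrightarrow> (z, - w) \<in> regular_normal_cone (gph D T) (x, T x) \<Longrightarrow>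
        \<kappa> * (norm w)\<^sup>2 \<le> z \<bullet> w"
  shows "\<kappa> * (norm (b - a))\<^sup>2 \<le> (T b - T a) \<bullet> (b - a)"
proof (rule ccontr)
  define w where "w = b - a"
  assume "\<not> ?thesis"
  then have lt: "w \<bullet> T b - w \<bullet> T a < \<kappa> * (norm w)\<^sup>2"
    by (simp add: w_def inner_commute inner_diff_right)
  have lip_w: "(norm w * L)-lipschitz_on U (\<lambda>y. w \<bullet> T y)"
  proof (rule lipschitz_onI)
    fix x y assume xy: "x \<in> U" "y \<in> U"
    have "dist (w \<bullet> T x) (w \<bullet> T y) \<le> norm w * norm (T x - T y)"
      by (metis Cauchy_Schwarz_ineq2 dist_real_def inner_diff_right)
    also have "\<dots> \<le> norm w * (L * dist x y)"
      using lipschitz_onD[OF lip xy] by (intro mult_left_mono) (auto simp: dist_norm)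
    finally show "dist (w \<bullet> T x) (w \<bullet> T y) \<le> norm w * L * dist x y" by (simp add: mult_ac)
  qed (use lipschitz_on_nonneg[OF lip] in simp)
  obtain x \<zeta> N where x: "x \<in> U" "N \<ge> 0" "\<zeta> \<bullet> (b - a) < \<kappa> * (norm w)\<^sup>2"
    and sub: "\<forall>\<^sub>F x' in nhds x. w \<bullet> T x' - w \<bullet> T x \<ge> \<zeta> \<bullet> (x' - x) - N * (norm (x' - x))\<^sup>2"
    using mean_value_proximal_subgradient[OF U(1,3) lip_w lt] by blast
  have "(\<zeta>, - w) \<in> regular_normal_cone (gph D T) (x, T x)"
    unfolding regular_normal_cone_gph_iff[OF U(1,2) x(1) lip]
  proof safe
    fix \<epsilon> :: real assume "\<epsilon> > 0"
    moreover have "((\<lambda>x'. N * norm (x' - x)) \<longlongrightarrow> N * norm (x - x)) (at x)"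
      by (intro tendsto_intros)
    ultimately have "\<forall>\<^sub>F x' in at x. N * norm (x' - x) < \<epsilon>"
      by (intro order_tendstoD) auto
    moreover have "\<forall>\<^sub>F x' in at x. w \<bullet> T x' - w \<bullet> T x \<ge> \<zeta> \<bullet> (x' - x) - N * (norm (x' - x))\<^sup>2"
      using sub by (simp add: eventually_at_filter eventually_mono)
    ultimately show "\<forall>\<^sub>F x' in at x. \<zeta> \<bullet> (x' - x) - w \<bullet> (T x' - T x) \<le> \<epsilon> * norm (x' - x)"
    proof eventually_elim
      case (elim x')
      have "N * (norm (x' - x))\<^sup>2 \<le> \<epsilon> * norm (x' - x)"
        using mult_right_mono[OF less_imp_le[OF elim(1)], of "norm (x' - x)"]
        by (simp add: power2_eq_square mult_ac)
      then show ?case using elim(2) by (simp add: inner_diff_right)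
    qed
  qed
  from bound[OF x(1) this] x(3) show False by (simp add: w_def)
qed

section \<open>A positive-definite coderivative gives a uniform bound\<close>

lemma regular_normal_cone_scaleR:
  assumes "\<zeta> \<in> regular_normal_cone \<Omega> z0" "r > 0"
  shows "r *\<^sub>R \<zeta> \<in> regular_normal_cone \<Omega> z0"
  unfolding regular_normal_cone_iff
proof safe
  fix \<epsilon> :: real assume "\<epsilon> > 0"
  then have "\<epsilon> / r > 0" using assms(2) by simp
  then have "\<forall>\<^sub>F z in at z0 within \<Omega>. \<zeta> \<bullet> (z - z0) \<le> \<epsilon> / r * norm (z - z0)"
    using assms(1) unfolding regular_normal_cone_iff by blast
  then show "\<forall>\<^sub>F z in at z0 within \<Omega>. (r *\<^sub>R \<zeta>) \<bullet> (z - z0) \<le> \<epsilon> * norm (z - z0)"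
    by eventually_elim (use assms(2) in \<open>simp add: field_simps\<close>)
qed

text \<open>
  If the bound fails for all \<open>\<kappa>\<close> and \<open>r\<close>, the cone property allows scaling the violating normals
  to \<open>|w| = 1\<close>, and then \<open>|z| \<le> L\<close> keeps them in a compact set; a cluster point is a limiting
  normal at \<open>xbar\<close> with \<open>|w| = 1\<close> and \<open>z \<bullet> w \<le> 0\<close>.
\<close>

lemma regular_normals_uniformly_positive:
  fixes T :: "'a::euclidean_space \<Rightarrow> 'a"
  assumes U: "open U" "U \<subseteq> D" "xbar \<in> U" and lip: "L-lipschitz_on U T"
    and pos: "\<And>w z. z \<in> limiting_coderivative D T xbar w \<Longrightarrow> w \<noteq> 0 \<Longrightarrow> z \<bullet> w > 0"
  obtains \<kappa> r where "\<kappa> > 0" "r > 0" "ball xbar r \<subseteq> U"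
    "\<And>x z w. x \<in> ball xbar r \<Longrightarrow> (z, - w) \<in> regular_normal_cone (gph D T) (x, T x) \<Longrightarrow>
        \<kappa> * (norm w)\<^sup>2 \<le> z \<bullet> w"
proof -
  obtain r0 where r0: "r0 > 0" "ball xbar r0 \<subseteq> U" using U open_contains_ball by blast
  define \<delta> where "\<delta> k = inverse (real (Suc k))" for k
  have \<delta>: "\<delta> k > 0" "\<delta> \<longlonglongrightarrow> 0" for k
    using LIMSEQ_inverse_real_of_nat unfolding \<delta>_def by simp_all
  have "\<exists>k. \<forall>x \<in> ball xbar (min r0 (\<delta> k)). \<forall>z w.
      (z, - w) \<in> regular_normal_cone (gph D T) (x, T x) \<longrightarrow> \<delta> k * (norm w)\<^sup>2 \<le> z \<bullet> w"
  proof (rule ccontr)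
    assume "\<not> ?thesis"
    then have "\<forall>k. \<exists>x z w. x \<in> ball xbar (min r0 (\<delta> k)) \<and>
        (z, - w) \<in> regular_normal_cone (gph D T) (x, T x) \<and> z \<bullet> w < \<delta> k * (norm w)\<^sup>2"
      by (simp add: not_le Bex_def)
    then obtain x z w where x: "\<And>k. x k \<in> ball xbar (min r0 (\<delta> k))"
      and nrm: "\<And>k. (z k, - w k) \<in> regular_normal_cone (gph D T) (x k, T (x k))"
      and neg: "\<And>k. z k \<bullet> w k < \<delta> k * (norm (w k))\<^sup>2"
      by metis
    have xU: "x k \<in> U" for k using x[of k] r0(2) by auto
    have w0: "w k \<noteq> 0" for k using neg[of k] by auto
    define z' w' where "z' k = z k /\<^sub>R norm (w k)" and "w' k = w k /\<^sub>R norm (w k)" for k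
    have w': "norm (w' k) = 1" for k using w0 by (simp add: w'_def)
    have nrm': "(z' k, - w' k) \<in> regular_normal_cone (gph D T) (x k, T (x k))" for k
      using regular_normal_cone_scaleR[OF nrm[of k], of "inverse (norm (w k))"] w0
      by (simp add: z'_def w'_def)
    have neg': "z' k \<bullet> w' k \<le> \<delta> k" for k
      using neg[of k] w0[of k] by (simp add: z'_def w'_def field_simps power2_eq_square)
    have "norm (z' k) \<le> L" for k
      using regular_normal_gph_norm_le[OF U(1,2) xU lip nrm'[of k]] w' by simp
    then have K: "\<forall>k. (z' k, w' k) \<in> cball 0 L \<times> sphere 0 1" using w' by simp
    have "compact (cball (0::'a) L \<times> sphere (0::'a) 1)" by (intro compact_Times) auto
    then obtain l s where s: "strict_mono (s :: nat \<Rightarrow> nat)"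
      and l: "l \<in> cball 0 L \<times> sphere 0 1" and lim: "((\<lambda>k. (z' k, w' k)) \<circ> s) \<longlonglongrightarrow> l"
      using K by (rule seq_compactE[OF compact_imp_seq_compact])
    obtain zl wl where zw: "l = (zl, wl)" by (cases l)
    have wl: "wl \<noteq> 0" using l zw by auto
    have zlim: "(\<lambda>k. z' (s k)) \<longlonglongrightarrow> zl" and wlim: "(\<lambda>k. w' (s k)) \<longlonglongrightarrow> wl"
      using tendsto_fst[OF lim] tendsto_snd[OF lim] by (simp_all add: zw o_def)
    have xlim: "x \<longlonglongrightarrow> xbar"
    proof -
      have "dist (x k) xbar \<le> \<delta> k" for k using x[of k] by (simp add: dist_commute)
      then have "(\<lambda>k. dist (x k) xbar) \<longlonglongrightarrow> 0"
        by (intro tendsto_sandwich[OF _ _ tendsto_const \<delta>(2)]) auto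
      then show ?thesis by (rule tendsto_dist_iff[THEN iffD2])
    qed
    have "isCont T xbar"
      using lipschitz_on_continuous_on[OF lip] U continuous_on_eq_continuous_at by blast
    then have plim: "(\<lambda>k. (x (s k), T (x (s k)))) \<longlonglongrightarrow> (xbar, T xbar)"
      using LIMSEQ_subseq_LIMSEQ[OF xlim s]
      by (intro tendsto_Pair) (auto simp: o_def intro: isCont_tendsto_compose)
    have "(zl, - wl) \<in> limiting_normal_cone (gph D T) (xbar, T xbar)"
      unfolding limiting_normal_cone_def
    proof (intro CollectI exI conjI allI)
      fix k show "(x (s k), T (x (s k))) \<in> gph D T" using xU U(2) by (auto simp: gph_def)
      show "(z' (s k), - w' (s k)) \<in> regular_normal_cone (gph D T) (x (s k), T (x (s k)))"
        by (rule nrm')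
      show "(\<lambda>k. (x (s k), T (x (s k)))) \<longlonglongrightarrow> (xbar, T xbar)" by (rule plim)
      show "(\<lambda>k. (z' (s k), - w' (s k))) \<longlonglongrightarrow> (zl, - wl)"
        by (intro tendsto_intros zlim wlim)
    qed
    then have "zl \<bullet> wl > 0" using pos[of zl wl] wl by (simp add: limiting_coderivative_def)
    moreover have "zl \<bullet> wl \<le> 0"
      by (rule LIMSEQ_le[OF tendsto_inner[OF zlim wlim] LIMSEQ_subseq_LIMSEQ[OF \<delta>(2) s]])
         (use neg' in \<open>auto simp: o_def\<close>)
    ultimately show False by simp
  qed
  then obtain k where k: "\<And>x z w. x \<in> ball xbar (min r0 (\<delta> k)) \<Longrightarrow>
      (z, - w) \<in> regular_normal_cone (gph D T) (x, T x) \<Longrightarrow> \<delta> k * (norm w)\<^sup>2 \<le> z \<bullet> w"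
    by blast
  have "min r0 (\<delta> k) > 0" "ball xbar (min r0 (\<delta> k)) \<subseteq> U" using r0 \<delta>(1) by auto
  then show thesis by (rule that[OF \<delta>(1) _ _ k])
qed

section \<open>The coderivative criterion\<close>

theorem corollary3p5:
  fixes T :: "'a::euclidean_space \<Rightarrow> 'a" and D :: "'a set" and xbar :: 'a
  assumes "xbar \<in> D"
    and "lipschitz_around D T xbar"
  shows "locally_strongly_monotone (gph D T) (xbar, T xbar) \<longleftrightarrow>
         (\<forall>w z. z \<in> limiting_coderivative D T xbar w \<and> w \<noteq> 0 \<longrightarrow> z \<bullet> w > 0)"
proof -
  obtain U L where U: "open U" "xbar \<in> U" "U \<subseteq> D" and lip: "L-lipschitz_on U T"
    using assms(2) unfolding lipschitz_around_def by blast
  show ?thesis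
  proof (intro iffI allI impI)
    fix w z
    assume mono: "locally_strongly_monotone (gph D T) (xbar, T xbar)"
      and zw: "z \<in> limiting_coderivative D T xbar w \<and> w \<noteq> 0"
    from mono obtain \<kappa> A B where \<kappa>: "\<kappa> > 0" and AB: "open A" "open B" "(xbar, T xbar) \<in> A \<times> B"
      and "\<forall>(u1, v1) \<in> gph D T \<inter> (A \<times> B). \<forall>(u2, v2) \<in> gph D T \<inter> (A \<times> B).
         (v1 - v2) \<bullet> (u1 - u2) \<ge> \<kappa> * (norm (u1 - u2))\<^sup>2"
      unfolding locally_strongly_monotone_def by (elim conjE exE) (rule that)
    then have m: "\<kappa> * (norm (x - y))\<^sup>2 \<le> (T x - T y) \<bullet> (x - y)"
      if "(x, T x) \<in> gph D T \<inter> (A \<times> B)" "(y, T y) \<in> gph D T \<inter> (A \<times> B)" for x y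
      using that by fast
    define W where "W = U \<inter> A \<inter> T -` B"
    have "open (U \<inter> T -` B)"
      using continuous_open_preimage[OF lipschitz_on_continuous_on[OF lip] U(1) AB(2)] .
    moreover have "W = A \<inter> (U \<inter> T -` B)" by (auto simp: W_def)
    ultimately have W: "open W" using AB(1) by (simp add: open_Int)
    have "W \<subseteq> U" by (auto simp: W_def)
    then have WU: "W \<subseteq> D" "L-lipschitz_on W T"
      using U(3) lipschitz_on_subset[OF lip] by auto
    have "\<kappa> * (norm w)\<^sup>2 \<le> z \<bullet> w"
    proof (rule limiting_coderivative_lower_bound[where W = "W \<times> UNIV"])
      fix y z w assume y: "(y, T y) \<in> W \<times> UNIV"
        and nrm: "(z, - w) \<in> regular_normal_cone (gph D T) (y, T y)"
      show "\<kappa> * (norm w)\<^sup>2 \<le> z \<bullet> w"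
      proof (rule regular_normal_gph_strongly_monotone[OF W WU(1) _ WU(2) _ nrm])
        show "y \<in> W" using y by simp
        fix x' assume "x' \<in> W"
        then show "\<kappa> * (norm (x' - y))\<^sup>2 \<le> (T x' - T y) \<bullet> (x' - y)"
          using y WU(1) by (intro m) (auto simp: gph_def W_def)
      qed
    qed (use W U AB zw in \<open>auto simp: W_def intro: open_Times\<close>)
    moreover have "\<kappa> * (norm w)\<^sup>2 > 0" using \<kappa> zw by simp
    ultimately show "z \<bullet> w > 0" by linarith
  next
    assume "\<forall>w z. z \<in> limiting_coderivative D T xbar w \<and> w \<noteq> 0 \<longrightarrow> z \<bullet> w > 0"
    then have pos: "\<And>w z. z \<in> limiting_coderivative D T xbar w \<Longrightarrow> w \<noteq> 0 \<Longrightarrow> z \<bullet> w > 0"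
      by blast
    obtain \<kappa> r where \<kappa>: "\<kappa> > 0" and r: "r > 0" "ball xbar r \<subseteq> U"
      and bound: "\<And>x z w. x \<in> ball xbar r \<Longrightarrow>
        (z, - w) \<in> regular_normal_cone (gph D T) (x, T x) \<Longrightarrow> \<kappa> * (norm w)\<^sup>2 \<le> z \<bullet> w"
      using regular_normals_uniformly_positive[OF U(1,3,2) lip pos] by metis
    have mono: "\<kappa> * (norm (b - a))\<^sup>2 \<le> (T b - T a) \<bullet> (b - a)"
      if ab: "a \<in> ball xbar r" "b \<in> ball xbar r" for a b
    proof (rule strongly_monotone_of_regular_normals[OF open_ball _ _ _ bound])
      show "ball xbar r \<subseteq> D" using r U by blast
      show "closed_segment a b \<subseteq> ball xbar r"
        using ab by (intro closed_segment_subset) auto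
      show "L-lipschitz_on (ball xbar r) T" using lip r(2) by (rule lipschitz_on_subset)
    qed
    show "locally_strongly_monotone (gph D T) (xbar, T xbar)"
      unfolding locally_strongly_monotone_def
    proof (rule conjI, goal_cases)
      case 2
      show ?case
        by (rule exI[of _ \<kappa>], rule conjI[OF \<kappa>], rule exI[of _ "ball xbar r"], rule exI[of _ UNIV])
          (use mono r(1) in \<open>auto simp: gph_def\<close>)
    qed (use assms(1) in \<open>simp add: gph_def\<close>)
  qed
qed

end
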